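(* Let $C_\infty$ and $C_1,C_2,C_3,C_4$ (indices mod $4$) form a $4$-flower in the Euclidean plane, with central circle $C_\infty$ of curvature $\kappa_\infty$ and petal circles $C_j$ of curvature $\kappa_j$. Then $$\begin{aligned} 16\kappa_\infty^4 &- 8\kappa_\infty^2(\kappa_1\kappa_2+\kappa_2\kappa_3+\kappa_3\kappa_4+\kappa_4\kappa_1+2\kappa_1\kappa_3+2\kappa_2\kappa_4)\\ &+(\kappa_1^2+\kappa_3^2)(\kappa_2^2+\kappa_4^2)-16\kappa_\infty(\kappa_1\kappa_2\kappa_3+\kappa_2\kappa_3\kappa_4+\kappa_3\kappa_4\kappa_1+\kappa_4\kappa_1\kappa_2)\\ &-12\kappa_1\kappa_2\kappa_3\kappa_4-2(\kappa_1\kappa_2+\kappa_3\kappa_4)(\kappa_2\kappa_3+\kappa_4\kappa_1)=0. \end{aligned}$$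
   Context: The curvature of a circle of radius $r>0$ in the Euclidean plane is $1/r$. For $n\ge 3$, an $n$-flower consists of a central circle $C_\infty$ and $n$ petal circles $C_j$, indexed by integers $j$ mod $n$, in the Euclidean plane, such that the $C_j$ are externally tangent to $C_\infty$ in order around $C_\infty$, and each $C_j$ is externally tangent to $C_{j-1}$ and $C_{j+1}$. Here "in order around $C_\infty$" means that the petals surround $C_\infty$ exactly once: if $p_j$ is the point of tangency of $C_j$ with $C_\infty$, then, moving along $C_\infty$ in one fixed direction (clockwise or anticlockwise), the angle at the centre of $C_\infty$ from $p_{j-1}$ to $p_j$ lies in $(0,\pi)$ for every $j$ mod $n$, and these $n$ angles sum to $2\pi$. *)

theory Defs
  imports "HOL-Analysis.Analysis"
begin

text \<open>The Euclidean plane is \<^typ>\<open>complex\<close>. Positivity of radii is not part of the type;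
  it is required where circles are used.\<close>

datatype circle = Circle (center: complex) (radius: real)

definition curvature :: "circle \<Rightarrow> real" where
  "curvature C = 1 / radius C"

definition points :: "circle \<Rightarrow> complex set" where
  "points C = sphere (center C) (radius C)"

definition inside_disc :: "circle \<Rightarrow> complex set" where
  "inside_disc C = ball (center C) (radius C)"

definition ext_tangent_at :: "circle \<Rightarrow> circle \<Rightarrow> complex \<Rightarrow> bool" where
  "ext_tangent_at C D p \<longleftrightarrow> points C \<inter> points D = {p} \<and> inside_disc C \<inter> inside_disc D = {}"

definition ext_tangent :: "circle \<Rightarrow> circle \<Rightarrow> bool" where
  "ext_tangent C D \<longleftrightarrow> (\<exists>p. ext_tangent_at C D p)"

text \<open>The angles below take values in \<open>[0, 2 * pi)\<close> and are meaningful for points other than \<open>c\<close>.\<close>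

definition anticlockwise_angle :: "complex \<Rightarrow> complex \<Rightarrow> complex \<Rightarrow> real" where
  "anticlockwise_angle c p q = Arg2pi ((q - c) / (p - c))"

definition clockwise_angle :: "complex \<Rightarrow> complex \<Rightarrow> complex \<Rightarrow> real" where
  "clockwise_angle c p q = anticlockwise_angle c q p"

text \<open>Families indexed by integers mod \<open>n\<close> are \<open>n\<close>-periodic functions on \<^typ>\<open>int\<close>.\<close>

definition surrounds_once ::
    "(complex \<Rightarrow> complex \<Rightarrow> complex \<Rightarrow> real) \<Rightarrow> nat \<Rightarrow> complex \<Rightarrow> (int \<Rightarrow> complex) \<Rightarrow> bool" where
  "surrounds_once ang n c p \<longleftrightarrow>
     (\<forall>j. 0 < ang c (p (j - 1)) (p j) \<and> ang c (p (j - 1)) (p j) < pi) \<and>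
     (\<Sum>j = 1..int n. ang c (p (j - 1)) (p j)) = 2 * pi"

definition flower :: "nat \<Rightarrow> circle \<Rightarrow> (int \<Rightarrow> circle) \<Rightarrow> bool" where
  "flower n Cinf C \<longleftrightarrow>
     n \<ge> 3 \<and>
     radius Cinf > 0 \<and> (\<forall>j. radius (C j) > 0) \<and>
     (\<forall>j. C (j + int n) = C j) \<and>
     (\<forall>j. ext_tangent (C j) (C (j - 1)) \<and> ext_tangent (C j) (C (j + 1))) \<and>
     (\<exists>p. (\<forall>j. ext_tangent_at (C j) Cinf (p j)) \<and>
          (surrounds_once anticlockwise_angle n (center Cinf) p \<or>
           surrounds_once clockwise_angle n (center Cinf) p))"

end

(* Half the angles between consecutive tangency points add up to pi, and the law of cosines gives
   sin^2 a_j = k^2 / ((k_{j-1} + k) (k_j + k)) for them, where k is the central curvature.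
   Hence sin a_1 sin a_3 = sin a_2 sin a_4, and cos (a_1 + a_3) = - cos (a_2 + a_4) becomes
   cos a_1 cos a_3 + cos a_2 cos a_4 = 2 sin a_1 sin a_3. Squaring twice removes the
   square roots. *)
theory Submission
  imports Defs
begin

text \<open>If the centres were closer than \<open>r + s\<close>, the point dividing the segment
  from \<open>a\<close> to \<open>b\<close> in the ratio \<open>r : s\<close> would lie in both
  balls.\<close>

lemma dist_ge_if_balls_disjoint:
  fixes a b :: "'a::real_normed_vector"
  assumes "ball a r \<inter> ball b s = {}" "r > 0" "s > 0"
  shows "r + s \<le> dist a b"
proof (rule ccontr)
  assume "\<not> r + s \<le> dist a b"
  then have less: "norm (b - a) < r + s"
    by (simp add: dist_norm norm_minus_commute)
  define z where "z = a + (r / (r + s)) *\<^sub>R (b - a)"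
  have "b - z = (s / (r + s)) *\<^sub>R (b - a)"
  proof -
    have "b - z = (1 - r / (r + s)) *\<^sub>R (b - a)"
      by (simp add: z_def algebra_simps)
    also have "1 - r / (r + s) = s / (r + s)"
      using assms by (simp add: field_simps)
    finally show ?thesis .
  qed
  moreover have "z - a = (r / (r + s)) *\<^sub>R (b - a)"
    by (simp add: z_def)
  ultimately have "norm (z - a) = r * (norm (b - a) / (r + s))"
      and "norm (b - z) = s * (norm (b - a) / (r + s))"
    using assms by simp_all
  moreover have "norm (b - a) / (r + s) < 1"
    using less assms by simp
  ultimately have "norm (z - a) < r" "norm (b - z) < s"
    using assms by (metis mult.right_neutral mult_strict_left_mono)+
  then have "z \<in> ball a r \<inter> ball b s"
    by (simp add: dist_norm norm_minus_commute)
  then show False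
    using assms by blast
qed

text \<open>The common point bounds the distance from above by the triangle inequality. The bound
  from below comes from disjointness of the open discs, which rules out internal tangency.\<close>

lemma ext_tangent_at_dist:
  assumes "ext_tangent_at C D p" "radius C > 0" "radius D > 0"
  shows "dist (center C) (center D) = radius C + radius D"
proof -
  have p: "dist (center C) p = radius C" "dist (center D) p = radius D"
    using assms(1) by (auto simp: ext_tangent_at_def points_def)
  have "dist (center C) (center D) \<ge> radius C + radius D"
    using assms by (intro dist_ge_if_balls_disjoint) (simp_all add: ext_tangent_at_def inside_disc_def)
  moreover have "dist (center C) (center D) \<le> radius C + radius D"
    using dist_triangle2[of "center C" "center D" p] p by simp
  ultimately show ?thesis by simp
qed

text \<open>Equality in the triangle inequality puts \<open>p\<close> on the segment joining the
  centres. This ties the angles between tangency points to the centres of the petals.\<close>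

lemma ext_tangent_at_center:
  assumes "ext_tangent_at C D p" "radius C > 0" "radius D > 0"
  shows "center C - center D = of_real ((radius D + radius C) / radius D) * (p - center D)"
proof -
  define x y where "x = p - center D" and "y = center C - p"
  have n: "norm x = radius D" "norm y = radius C"
    using assms(1) by (auto simp: ext_tangent_at_def points_def x_def y_def dist_norm norm_minus_commute)
  have "norm (x + y) = norm x + norm y"
    using ext_tangent_at_dist[OF assms] n by (simp add: x_def y_def dist_norm)
  then have "radius D *\<^sub>R y = radius C *\<^sub>R x"
    using norm_triangle_eq[of x y] n by simp
  then have "of_real (radius D) * y = of_real (radius C) * x"
    by (simp add: scaleR_conv_of_real)
  then have "of_real (radius D) * (x + y) = of_real (radius D + radius C) * x"
    by (simp add: algebra_simps)
  then have "x + y = of_real ((radius D + radius C) / radius D) * x"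
    using assms(3) by (simp add: nonzero_eq_divide_eq mult.commute)
  then show ?thesis
    by (simp add: x_def y_def)
qed

text \<open>Law of cosines in the triangle of the three centres, whose sides are sums of two radii.
  The right-hand side is symmetric in \<open>C\<close> and \<open>D\<close>, so the formula serves
  both orientations.\<close>

lemma sin_half_angle_between_petals:
  assumes CD: "ext_tangent C D"
    and C: "ext_tangent_at C E p" and D: "ext_tangent_at D E q"
    and pos: "radius C > 0" "radius D > 0" "radius E > 0"
  shows "(sin (anticlockwise_angle (center E) p q / 2))\<^sup>2 =
    (curvature E)\<^sup>2 / ((curvature C + curvature E) * (curvature D + curvature E))"
proof -
  define c d r where "c = radius C" and "d = radius D" and "r = radius E"
  define x y where "x = p - center E" and "y = q - center E"
  define t where "t = anticlockwise_angle (center E) p q"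
  have pos': "c > 0" "d > 0" "r > 0"
    using pos by (auto simp: c_def d_def r_def)
  have n: "norm x = r" "norm y = r"
    using C D by (auto simp: ext_tangent_at_def points_def x_def y_def r_def dist_norm norm_minus_commute)
  have x0: "x \<noteq> 0"
    using n pos' by auto
  have "y / x = of_real (norm (y / x)) * exp (\<i> * of_real t)"
    unfolding t_def anticlockwise_angle_def x_def y_def
    using Arg2pi by (simp add: is_Arg_def)
  then have y: "y = x * cis t"
    using n pos' x0 by (simp add: norm_divide cis_conv_exp field_simps)
  have "norm (center C - center D) = c + d"
    using CD ext_tangent_at_dist[of C D] pos by (auto simp: ext_tangent_def dist_norm c_def d_def)
  moreover have "center C - center D = of_real ((r + c) / r) * x - of_real ((r + d) / r) * y"
    using ext_tangent_at_center[OF C] ext_tangent_at_center[OF D] pos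
    unfolding c_def d_def r_def x_def y_def by (metis diff_diff_eq2 diff_add_cancel)
  moreover have "\<dots> = x / of_real r * (of_real (r + c) - of_real (r + d) * cis t)"
    using pos' by (simp add: y field_simps)
  ultimately have "c + d = norm (of_real (r + c) - of_real (r + d) * cis t)"
    using n pos' by (simp add: norm_mult norm_divide)
  then have "(c + d)\<^sup>2 = ((r + c) - (r + d) * cos t)\<^sup>2 + ((r + d) * sin t)\<^sup>2"
    by (simp add: cmod_power2)
  also have "\<dots> = (r + c)\<^sup>2 - 2 * (r + c) * (r + d) * cos t + (r + d)\<^sup>2"
    using sin_cos_squared_add[of t] by algebra
  \<comment> \<open>With the half angle, the right-hand side becomes \<open>(c - d)\<^sup>2\<close>
    plus a multiple of the squared sine, and
    \<open>(c + d)\<^sup>2 - (c - d)\<^sup>2 = 4 * c * d\<close>.\<close>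
  also have "cos t = 1 - 2 * (sin (t / 2))\<^sup>2"
    using cos_double_sin[of "t / 2"] by simp
  finally have "(r + c) * (r + d) * (sin (t / 2))\<^sup>2 = c * d"
    by algebra
  then have "(sin (t / 2))\<^sup>2 = c * d / ((r + c) * (r + d))"
    using pos' by (simp add: nonzero_eq_divide_eq mult.commute)
  \<comment> \<open>Dividing numerator and denominator by \<open>c * d * r\<^sup>2\<close> passes
    from radii to curvatures.\<close>
  also have "\<dots> = (1 / r)\<^sup>2 / ((1 / c + 1 / r) * (1 / d + 1 / r))"
    using pos' by (simp add: divide_simps power2_eq_square)
  finally show ?thesis
    by (simp add: t_def curvature_def c_def d_def r_def)
qed

lemma cos_products_of_angles_sum_pi:
  fixes a b c d :: real
  assumes "a + b + c + d = pi"
  shows "cos a * cos c + cos b * cos d = sin a * sin c + sin b * sin d"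
proof -
  have "cos (a + c) = cos (pi - (b + d))"
    using assms by (intro arg_cong[where f = cos]) linarith
  then show ?thesis
    by (simp add: cos_add)
qed

text \<open>The purely algebraic elimination: \<open>k\<close> stands for the central curvature, the
  \<open>x\<close>s for the petal curvatures and \<open>a\<close>, \<open>b\<close>,
  \<open>c\<close>, \<open>d\<close> for the half angles.\<close>

lemma four_flower_polynomial_of_half_angles:
  fixes k x1 x2 x3 x4 a b c d :: real
  assumes pos: "k > 0" "x1 > 0" "x2 > 0" "x3 > 0" "x4 > 0"
    and sin_pos: "sin a > 0" "sin b > 0" "sin c > 0" "sin d > 0"
    and sum: "a + b + c + d = pi"
    and a: "(sin a)\<^sup>2 = k\<^sup>2 / ((x4 + k) * (x1 + k))"
    and b: "(sin b)\<^sup>2 = k\<^sup>2 / ((x1 + k) * (x2 + k))"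
    and c: "(sin c)\<^sup>2 = k\<^sup>2 / ((x2 + k) * (x3 + k))"
    and d: "(sin d)\<^sup>2 = k\<^sup>2 / ((x3 + k) * (x4 + k))"
  shows "16 * k ^ 4
     - 8 * k ^ 2 * (x1 * x2 + x2 * x3 + x3 * x4 + x4 * x1 + 2 * x1 * x3 + 2 * x2 * x4)
     + (x1 ^ 2 + x3 ^ 2) * (x2 ^ 2 + x4 ^ 2)
     - 16 * k * (x1 * x2 * x3 + x2 * x3 * x4 + x3 * x4 * x1 + x4 * x1 * x2)
     - 12 * x1 * x2 * x3 * x4
     - 2 * (x1 * x2 + x3 * x4) * (x2 * x3 + x4 * x1) = 0" (is "?P = 0")
proof -
  \<comment> \<open>\<open>m\<close> is the common denominator for both pairs of opposite angles;
    \<open>U\<close> and \<open>V\<close> will be the polynomials \<open>m * u\<^sup>2\<close> and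
    \<open>m * v\<^sup>2\<close>.\<close>
  define m where "m = (x1 + k) * (x2 + k) * (x3 + k) * (x4 + k)"
  define s where "s = sin a * sin c"
  define u v where "u = cos a * cos c" and "v = cos b * cos d"
  define U V where "U = ((x4 + k) * (x1 + k) - k\<^sup>2) * ((x2 + k) * (x3 + k) - k\<^sup>2)"
    and "V = ((x1 + k) * (x2 + k) - k\<^sup>2) * ((x3 + k) * (x4 + k) - k\<^sup>2)"
  have nz: "x1 + k \<noteq> 0" "x2 + k \<noteq> 0" "x3 + k \<noteq> 0" "x4 + k \<noteq> 0"
    using pos by linarith+
  have "s\<^sup>2 = (sin b * sin d)\<^sup>2"
    by (simp add: s_def power_mult_distrib a b c d mult_ac)
  then have s: "s = sin b * sin d"
    using sin_pos by (simp add: s_def power2_eq_iff_nonneg)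
  have uv: "u + v = 2 * s"
    using cos_products_of_angles_sum_pi[OF sum] by (simp add: u_def v_def s[symmetric] s_def[symmetric])
  have S: "m * s\<^sup>2 = k ^ 4"
    using nz by (simp add: m_def s_def power_mult_distrib a c flip: power_add)
  have U: "m * u\<^sup>2 = U"
    using nz by (simp add: m_def u_def U_def power_mult_distrib cos_squared_eq a c divide_simps)
  have V: "m * v\<^sup>2 = V"
    using nz by (simp add: m_def v_def V_def power_mult_distrib cos_squared_eq b d divide_simps)
  \<comment> \<open>Only the squares of \<open>s\<close>, \<open>u\<close> and \<open>v\<close> are
    rational in the curvatures. Isolating \<open>u * v\<close> before squaring again leaves nothing
    but squares.\<close>
  have "4 * s\<^sup>2 - u\<^sup>2 - v\<^sup>2 = 2 * u * v"
    using uv by algebra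
  then have "(4 * (m * s\<^sup>2) - m * u\<^sup>2 - m * v\<^sup>2)\<^sup>2 = 4 * (m * u\<^sup>2) * (m * v\<^sup>2)"
    by algebra
  then have "(4 * k ^ 4 - U - V)\<^sup>2 = 4 * U * V"
    by (simp add: S U V)
  \<comment> \<open>The elimination produces the extra factor \<open>k ^ 4\<close>, which is
    nonzero.\<close>
  moreover have "(4 * k ^ 4 - U - V)\<^sup>2 - 4 * U * V = k ^ 4 * ?P"
    unfolding U_def V_def by algebra
  ultimately show ?thesis
    using pos by simp
qed

theorem mainTheorem2:
  fixes Cinf :: circle and C :: "int \<Rightarrow> circle"
    and \<kappa>inf :: real and \<kappa> :: "int \<Rightarrow> real"
  assumes "flower 4 Cinf C"
  defines "\<kappa>inf \<equiv> curvature Cinf"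
    and "\<kappa> \<equiv> (\<lambda>j. curvature (C j))"
  shows "16 * \<kappa>inf ^ 4
     - 8 * \<kappa>inf ^ 2 * (\<kappa> 1 * \<kappa> 2 + \<kappa> 2 * \<kappa> 3 + \<kappa> 3 * \<kappa> 4 + \<kappa> 4 * \<kappa> 1
                      + 2 * \<kappa> 1 * \<kappa> 3 + 2 * \<kappa> 2 * \<kappa> 4)
     + (\<kappa> 1 ^ 2 + \<kappa> 3 ^ 2) * (\<kappa> 2 ^ 2 + \<kappa> 4 ^ 2)
     - 16 * \<kappa>inf * (\<kappa> 1 * \<kappa> 2 * \<kappa> 3 + \<kappa> 2 * \<kappa> 3 * \<kappa> 4 + \<kappa> 3 * \<kappa> 4 * \<kappa> 1 + \<kappa> 4 * \<kappa> 1 * \<kappa> 2)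
     - 12 * \<kappa> 1 * \<kappa> 2 * \<kappa> 3 * \<kappa> 4
     - 2 * (\<kappa> 1 * \<kappa> 2 + \<kappa> 3 * \<kappa> 4) * (\<kappa> 2 * \<kappa> 3 + \<kappa> 4 * \<kappa> 1) = 0"
proof -
  have pos: "radius Cinf > 0" "\<And>j. radius (C j) > 0"
    and per: "\<And>j. C (j + 4) = C j"
    and tan: "\<And>j. ext_tangent (C j) (C (j - 1))" "\<And>j. ext_tangent (C j) (C (j + 1))"
    using assms(1) by (auto simp: flower_def)
  obtain p ang where p: "\<And>j. ext_tangent_at (C j) Cinf (p j)"
    and ang: "ang = anticlockwise_angle \<or> ang = clockwise_angle"
    and once: "surrounds_once ang 4 (center Cinf) p"
    using assms(1) by (auto simp: flower_def)
  define h where "h j = ang (center Cinf) (p (j - 1)) (p j) / 2" for j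
  have h: "0 < h j" "h j < pi / 2" for j
    using once by (auto simp: surrounds_once_def h_def)
  have sin_pos: "sin (h j) > 0" for j
    using h[of j] by (intro sin_gt_zero) linarith+
  have "{1..int 4} = {1, 2, 3, 4}"
    by auto
  then have sum: "h 1 + h 2 + h 3 + h 4 = pi"
    using once by (simp add: surrounds_once_def h_def)
  \<comment> \<open>A clockwise angle is the anticlockwise one with the two petals
    exchanged.\<close>
  have sin_sq: "(sin (h j))\<^sup>2 = \<kappa>inf\<^sup>2 / ((\<kappa> (j - 1) + \<kappa>inf) * (\<kappa> j + \<kappa>inf))" for j
    using ang
  proof
    assume "ang = anticlockwise_angle"
    then show ?thesis
      using sin_half_angle_between_petals[OF _ p[of "j - 1"] p[of j]] tan(2)[of "j - 1"] pos
      by (simp add: h_def \<kappa>inf_def \<kappa>_def)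
  next
    assume "ang = clockwise_angle"
    then show ?thesis
      using sin_half_angle_between_petals[OF tan(1) p[of j] p[of "j - 1"]] pos
      by (simp add: h_def \<kappa>inf_def \<kappa>_def clockwise_angle_def mult.commute)
  qed
  \<comment> \<open>\<open>h 1\<close> is the half angle between petals 0 and 1, so periodicity is
    needed to close the cycle at petal 4.\<close>
  have "\<kappa> 0 = \<kappa> 4"
    using per[of 0] by (simp add: \<kappa>_def)
  moreover have "\<kappa>inf > 0" "\<kappa> j > 0" for j
    using pos by (simp_all add: \<kappa>inf_def \<kappa>_def curvature_def)
  ultimately show ?thesis
    using sin_sq[of 1] sin_sq[of 2] sin_sq[of 3] sin_sq[of 4] sin_pos sum
    by (intro four_flower_polynomial_of_half_angles[of _ _ _ _ _ "h 1" "h 2" "h 3" "h 4"]) simp_all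
qed

end
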